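(* Let $A=[a_{ij}]$ be an $n\times n$ pairwise reciprocal matrix, let $D$ be its design matrix, let $G=D^TD$ be its Gram matrix, and let $w$ be the Pseudo-IGM weight vector of $A$, i.e. $w=\frac{v}{v e^T}$ where $v^T=(D^TD)^{-1}D^Tq^T$ and $q=(0,\ldots,0,1)$. Then $$w=\frac{eG^{-1}}{eG^{-1}e^T}=\frac{e(D^TD)^{-1}}{e(D^TD)^{-1}e^T}.$$ Moreover, $G$ and $G^{-1}$ are symmetric, so that the vector of column sums $eG^{-1}$ and the vector of row sums $G^{-1}e^T$ have the same entries; $eG^{-1}e^T$ is the sum of the entries of $eG^{-1}$; and $\sum_{i=1}^n w_i=1$.
   Context: A pairwise reciprocal matrix (PRM) of size $n\ge 2$ is a real $n\times n$ matrix $A=[a_{ij}]$ with $0<a_{ij}=a_{ji}^{-1}$ for all $i,j\in\{1,\ldots,n\}$ (in particular $a_{ii}=1$). $e=(1,\ldots,1)$ denotes the row vector of ones of length $n$. Design matrix: $\bar D$ is the $n(n-1)\times n$ matrix whose rows are, for each pair $(i,j)$ with $1\le i<j\le n$ (in lexicographic order), the two rows: (i) the row with entry $1$ in column $i$, entry $-a_{ij}$ in column $j$ and $0$ elsewhere; (ii) the row with entry $-a_{ji}$ in column $i$, entry $1$ in column $j$ and $0$ elsewhere. These rows are the coefficients of the equations $w_i-a_{ij}w_j=0$, $i\ne j$, up to the order of the rows. The design matrix is $D=\begin{bmatrix}\bar D\\ e\end{bmatrix}$, of size $(n(n-1)+1)\times n$, the last row corresponding to $\sum_i w_i=1$. The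 Gram matrix is $G=D^TD$. The row vector $q=(0,\ldots,0,1)$ has length $n(n-1)+1$; the system of linear equations underlying the method is $Dw^T=q^T$. The unnormalized Pseudo-IGM (Pseudo Inverse Gram Matrix) solution is the row vector $v$ of length $n$ given by $v^T=(D^TD)^{-1}D^Tq^T$, and the Pseudo-IGM weight vector is its normalization $w=v/(ve^T)$. *)

theory Defs
  imports "Jordan_Normal_Form.Gauss_Jordan_Elimination"
begin

text \<open>
  Indices are 0-based: the pairs \<open>1 \<le> i < j \<le> n\<close> appear here as \<open>i < j < n\<close>.
  Row vectors of length \<open>n\<close> are \<open>1 \<times> n\<close> matrices, so that products such as
  \<open>e * G\<^sup>-\<^sup>1 * e\<^sup>T\<close> are ordinary matrix products, with a \<open>1 \<times> 1\<close> matrix as value.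
\<close>

definition pairwise_reciprocal_mat :: "nat \<Rightarrow> real mat \<Rightarrow> bool" where
  "pairwise_reciprocal_mat n A \<longleftrightarrow>
     n \<ge> 2 \<and> A \<in> carrier_mat n n \<and>
     (\<forall>i<n. \<forall>j<n. 0 < A $$ (i, j) \<and> A $$ (i, j) = inverse (A $$ (j, i)))"

definition ones_row :: "nat \<Rightarrow> real mat" where
  "ones_row n = mat 1 n (\<lambda>_. 1)"

definition scalar_of_mat :: "'a mat \<Rightarrow> 'a" where
  "scalar_of_mat M = M $$ (0, 0)"

text \<open>\<open>mat_inverse\<close> returns \<open>None\<close> on singular matrices, so \<open>mat_inv\<close> is
  meaningful for invertible matrices only.\<close>

definition mat_inv :: "'a :: field mat \<Rightarrow> 'a mat" where
  "mat_inv M = the (mat_inverse M)"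

lemma mat_inv:
  assumes "invertible_mat M" and "M \<in> carrier_mat n n"
  shows "mat_inv M \<in> carrier_mat n n" "M * mat_inv M = 1\<^sub>m n" "mat_inv M * M = 1\<^sub>m n"
proof -
  obtain B where B: "M * B = 1\<^sub>m (dim_row M)" "B * M = 1\<^sub>m (dim_row B)"
    using assms(1) unfolding invertible_mat_def inverts_mat_def by blast
  have "dim_row B = n"
    using arg_cong[OF B(2), of dim_col] assms(2) by simp
  moreover have "dim_col B = n"
    using arg_cong[OF B(1), of dim_col] assms(2) by simp
  ultimately have "B \<in> carrier_mat n n" "M * B = 1\<^sub>m n" "B * M = 1\<^sub>m n"
    using B assms(2) by auto
  hence "M \<in> Units (ring_mat TYPE('a) n ())"
    using assms(2) by (auto simp: Units_def ring_mat_simps)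
  then obtain C where "mat_inverse M = Some C"
    using mat_inverse(1)[OF assms(2), of "()"] by (cases "mat_inverse M") auto
  thus "mat_inv M \<in> carrier_mat n n" "M * mat_inv M = 1\<^sub>m n" "mat_inv M * M = 1\<^sub>m n"
    using mat_inverse(2)[OF assms(2)] by (simp_all add: mat_inv_def)
qed

definition index_pairs :: "nat \<Rightarrow> (nat \<times> nat) list" where
  "index_pairs n = [(i, j). i \<leftarrow> [0..<n], j \<leftarrow> [Suc i..<n]]"

definition equation_row :: "real mat \<Rightarrow> nat \<Rightarrow> nat \<Rightarrow> real vec" where
  "equation_row A i j =
     vec (dim_row A) (\<lambda>k. if k = i then 1 else if k = j then - A $$ (i, j) else 0)"

definition design_mat_bar :: "real mat \<Rightarrow> real mat" where
  "design_mat_bar A =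
     mat_of_rows (dim_row A)
       (concat (map (\<lambda>(i, j). [equation_row A i j, equation_row A j i]) (index_pairs (dim_row A))))"

definition design_mat :: "real mat \<Rightarrow> real mat" where
  "design_mat A = design_mat_bar A @\<^sub>r ones_row (dim_row A)"

definition gram_mat :: "real mat \<Rightarrow> real mat" where
  "gram_mat A = transpose_mat (design_mat A) * design_mat A"

definition rhs_row :: "nat \<Rightarrow> real mat" where
  "rhs_row n = mat 1 (n * (n - 1) + 1) (\<lambda>(_, k). if k = n * (n - 1) then 1 else 0)"

definition pseudo_igm_unnormalized :: "real mat \<Rightarrow> real mat" where
  "pseudo_igm_unnormalized A =
     transpose_mat
       (mat_inv (transpose_mat (design_mat A) * design_mat A) * transpose_mat (design_mat A)
         * transpose_mat (rhs_row (dim_row A)))"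

definition pseudo_igm :: "real mat \<Rightarrow> real mat" where
  "pseudo_igm A =
     (1 / scalar_of_mat (pseudo_igm_unnormalized A * transpose_mat (ones_row (dim_row A))))
       \<cdot>\<^sub>m pseudo_igm_unnormalized A"

lemma length_index_pairs: "2 * length (index_pairs n) = n * (n - 1)"
proof -
  have "length (index_pairs n) = (\<Sum>i<n. n - Suc i)"
    by (simp add: index_pairs_def length_concat comp_def interv_sum_list_conv_sum_set_nat
        lessThan_atLeast0)
  also have "\<dots> = (\<Sum>i<n. i)"
    by (rule sum.nat_diff_reindex)
  also have "2 * \<dots> = n * (n - 1)"
  proof (induction n)
    case (Suc n)
    thus ?case by (cases n) (auto simp: lessThan_Suc)
  qed simp
  finally show ?thesis .
qed

lemma design_mat_bar_carrier:
  assumes "A \<in> carrier_mat n n"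
  shows "design_mat_bar A \<in> carrier_mat (n * (n - 1)) n"
proof -
  have "length (concat (map (\<lambda>(i, j). [equation_row A i j, equation_row A j i]) ps))
      = 2 * length ps" for ps
    by (induction ps) auto
  thus ?thesis
    using assms length_index_pairs[of n] by (auto simp: design_mat_bar_def mat_of_rows_def)
qed

lemma design_mat_carrier:
  assumes "A \<in> carrier_mat n n"
  shows "design_mat A \<in> carrier_mat (n * (n - 1) + 1) n"
proof -
  have "ones_row (dim_row A) \<in> carrier_mat 1 n"
    using assms by (simp add: ones_row_def)
  thus ?thesis
    unfolding design_mat_def by (rule carrier_append_rows[OF design_mat_bar_carrier[OF assms]])
qed

end

theory Submission
  imports Defs "Jordan_Normal_Form.Determinant"
begin

text \<open>
  If \<open>D x = 0\<close>, then \<open>x\<^sub>i = a\<^sub>i\<^sub>1 x\<^sub>1\<close> for all \<open>i\<close> and \<open>\<Sum>x\<^sub>i = 0\<close>; since the \<open>a\<^sub>i\<^sub>1\<close> are positive,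
  \<open>x = 0\<close>. Hence \<open>G = D\<^sup>TD\<close> is positive definite, in particular invertible, and
  \<open>e G\<^sup>-\<^sup>1 e\<^sup>T = z\<^sup>T G z > 0\<close> for \<open>z = G\<^sup>-\<^sup>1 e\<^sup>T\<close>. As \<open>q D\<close> is the last row \<open>e\<close> of \<open>D\<close>, the symmetry
  of \<open>G\<^sup>-\<^sup>1\<close> turns \<open>v\<close> into \<open>e G\<^sup>-\<^sup>1\<close>.
\<close>

section \<open>Sums of squares, quadratic forms and matrix inverses\<close>

lemma scalar_prod_self_eq_0_iff:
  fixes x :: "'a :: linordered_idom vec"
  shows "x \<bullet> x = 0 \<longleftrightarrow> x = 0\<^sub>v (dim_vec x)"
proof -
  have "x \<bullet> x = 0 \<longleftrightarrow> (\<forall>i<dim_vec x. x $ i = 0)"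
    by (auto simp: scalar_prod_def sum_nonneg_eq_0_iff)
  thus ?thesis by (simp add: vec_eq_iff)
qed

lemma scalar_prod_self_nonneg:
  fixes x :: "'a :: linordered_idom vec"
  shows "0 \<le> x \<bullet> x"
  by (auto simp: scalar_prod_def intro: sum_nonneg)

text \<open>Moving the transpose of \<open>D\<close> across the scalar product turns the quadratic
  form of the Gram matrix into a sum of squares, so that its definiteness reduces to injectivity of
  \<open>D\<close>.\<close>

lemma transpose_mult_self_quadratic_form:
  fixes D :: "'a :: comm_semiring_0 mat"
  assumes "D \<in> carrier_mat m n" and "x \<in> carrier_vec n"
  shows "((transpose_mat D * D) *\<^sub>v x) \<bullet> x = (D *\<^sub>v x) \<bullet> (D *\<^sub>v x)"
proof -
  have "(transpose_mat D * D) *\<^sub>v x = transpose_mat D *\<^sub>v (D *\<^sub>v x)"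
    using assms by (intro assoc_mult_mat_vec) auto
  thus ?thesis
    using transpose_vec_mult_scalar[OF assms, of "D *\<^sub>v x"] assms by simp
qed

lemma invertible_mat_if_det_nonzero:
  fixes M :: "'a :: field mat"
  assumes "M \<in> carrier_mat n n" and "det M \<noteq> 0"
  shows "invertible_mat M"
proof -
  obtain B where "B \<in> carrier_mat n n" "M * B = 1\<^sub>m n" "B * M = 1\<^sub>m n"
    using det_non_zero_imp_unit[OF assms, of "()"]
    by (auto simp: Units_def ring_mat_simps)
  thus ?thesis
    using assms(1) unfolding invertible_mat_def inverts_mat_def by auto
qed

text \<open>Transposing \<open>M * mat_inv M = 1\<close> shows that the transposed inverse is a left
  inverse of \<open>M\<close>. A left inverse agrees with the two-sided inverse by
  associativity.\<close>

lemma transpose_mat_inv_symmetric: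
  fixes M :: "'a :: field mat"
  assumes "invertible_mat M" and M: "M \<in> carrier_mat n n" and sym: "transpose_mat M = M"
  shows "transpose_mat (mat_inv M) = mat_inv M"
proof -
  note inv = mat_inv[OF assms(1) M]
  let ?B = "transpose_mat (mat_inv M)"
  have B: "?B \<in> carrier_mat n n" using inv(1) by simp
  have "?B * M = transpose_mat (M * mat_inv M)"
    using transpose_mult[OF M inv(1)] sym by simp
  hence "?B * M = 1\<^sub>m n" using inv(2) by simp
  hence "?B * (M * mat_inv M) = mat_inv M"
    using assoc_mult_mat[OF B M inv(1)] inv(1) by simp
  thus ?thesis using inv(2) B by simp
qed

section \<open>Column and row sums as products with the vector of ones\<close>

lemma ones_row_carrier: "ones_row n \<in> carrier_mat 1 n"
  by (simp add: ones_row_def)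

lemma ones_row_mult_index:
  assumes "M \<in> carrier_mat n k" and "i < k"
  shows "(ones_row n * M) $$ (0, i) = (\<Sum>j<n. M $$ (j, i))"
  using assms by (auto simp: ones_row_def scalar_prod_def lessThan_atLeast0)

lemma mult_ones_col_index:
  assumes "M \<in> carrier_mat k n" and "i < k"
  shows "(M * transpose_mat (ones_row n)) $$ (i, 0) = (\<Sum>j<n. M $$ (i, j))"
  using assms by (auto simp: ones_row_def scalar_prod_def lessThan_atLeast0)

lemma mult_mat_vec_ones_index:
  fixes M :: "'a :: semiring_1 mat"
  assumes "M \<in> carrier_mat k n" and "i < k"
  shows "(M *\<^sub>v vec n (\<lambda>_. 1)) $ i = (\<Sum>j<n. M $$ (i, j))"
  using assms by (auto simp: scalar_prod_def lessThan_atLeast0)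

section \<open>Rows and kernel of the design matrix\<close>

lemma equation_row_in_design_mat_bar_rows:
  assumes A: "A \<in> carrier_mat n n" and "i < n" "j < n" "i \<noteq> j"
  shows "equation_row A i j \<in> set (rows (design_mat_bar A))"
proof -
  let ?rs = "concat (map (\<lambda>(i, j). [equation_row A i j, equation_row A j i]) (index_pairs n))"
  \<comment> \<open>\<open>index_pairs\<close> lists each pair with the smaller index first, and
    each pair contributes the rows of both orders. The row for \<open>i\<close> and \<open>j\<close>
    is therefore found under the sorted pair.\<close>
  have "(min i j, max i j) \<in> set (index_pairs n)"
    using assms by (auto simp: index_pairs_def image_iff min_def max_def)
  moreover have "equation_row A i j \<in>
      set [equation_row A (min i j) (max i j), equation_row A (max i j) (min i j)]"
    by (auto simp: min_def max_def)
  ultimately have "equation_row A i j \<in> set ?rs" by force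
  \<comment> \<open>\<open>rows\<close> recovers the list given to \<open>mat_of_rows n\<close> once
    all its vectors are known to have length \<open>n\<close>.\<close>
  moreover have "set ?rs \<subseteq> carrier_vec n"
    using A by (auto simp: equation_row_def)
  ultimately show ?thesis
    using A by (simp add: design_mat_bar_def)
qed

lemma equation_row_scalar_prod:
  assumes A: "A \<in> carrier_mat n n" and x: "x \<in> carrier_vec n"
    and ij: "i < n" "j < n" "i \<noteq> j"
  shows "equation_row A i j \<bullet> x = x $ i - A $$ (i, j) * x $ j"
proof -
  \<comment> \<open>As \<open>i\<close> and \<open>j\<close> differ, the nested conditional splits
    into a sum of two one-point terms.\<close>
  have "equation_row A i j \<bullet> x
      = (\<Sum>k<n. (if k = i then x $ i else 0) + (if k = j then - A $$ (i, j) * x $ j else 0))"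
    using A x ij by (auto simp: equation_row_def scalar_prod_def lessThan_atLeast0 intro!: sum.cong)
  also have "\<dots> = x $ i - A $$ (i, j) * x $ j"
    using ij by (simp add: sum.distrib)
  finally show ?thesis .
qed

text \<open>Positivity of \<open>A\<close> enters twice: it makes the diagonal entry 1 rather than
  -1, and it keeps the sum of column 0 away from zero. Index 0 plays the part of index 1 in the
  outline above.\<close>

lemma design_mat_kernel_trivial:
  assumes prm: "pairwise_reciprocal_mat n A" and x: "x \<in> carrier_vec n"
    and ker: "design_mat A *\<^sub>v x = 0\<^sub>v (n * (n - 1) + 1)"
  shows "x = 0\<^sub>v n"
proof -
  have A: "A \<in> carrier_mat n n" and "2 \<le> n"
    and pos: "\<And>i j. i < n \<Longrightarrow> j < n \<Longrightarrow> 0 < A $$ (i, j)"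
    using prm unfolding pairwise_reciprocal_mat_def by blast+
  hence n: "0 < n" by simp
  \<comment> \<open>The design matrix has no equation for the pair (0, 0), so the case
    \<open>i = 0\<close> of \<open>xi\<close> below rests on the diagonal entry, which is positive
    and its own inverse.\<close>
  have "A $$ (0, 0) = inverse (A $$ (0, 0))"
    using prm n unfolding pairwise_reciprocal_mat_def by blast
  hence "A $$ (0, 0) * A $$ (0, 0) = 1"
    using pos[OF n n] by (metis left_inverse less_irrefl)
  hence A00: "A $$ (0, 0) = 1"
    using pos[OF n n] by (simp add: square_eq_1_iff)
  note bar = design_mat_bar_carrier[OF A]
  have "design_mat A = design_mat_bar A @\<^sub>r ones_row n"
    using A by (simp add: design_mat_def)
  hence "(design_mat_bar A *\<^sub>v x) @\<^sub>v (ones_row n *\<^sub>v x) = 0\<^sub>v (n * (n - 1) + 1)"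
    using ker mat_mult_append[OF bar ones_row_carrier x] by simp
  \<comment> \<open>The zero vector is cut where the block \<open>ones_row n\<close> begins, so that
    the two blocks can be compared separately.\<close>
  also have "\<dots> = 0\<^sub>v (n * (n - 1)) @\<^sub>v 0\<^sub>v 1"
    by (rule eq_vecI) auto
  finally have "design_mat_bar A *\<^sub>v x = 0\<^sub>v (n * (n - 1)) \<and> ones_row n *\<^sub>v x = 0\<^sub>v 1"
    using append_vec_eq[OF mult_mat_vec_carrier[OF bar x] zero_carrier_vec] by blast
  hence bar0: "design_mat_bar A *\<^sub>v x = 0\<^sub>v (n * (n - 1))" and ones0: "ones_row n *\<^sub>v x = 0\<^sub>v 1"
    by blast+
  have row: "r \<bullet> x = 0" if r: "r \<in> set (rows (design_mat_bar A))" for r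
  proof -
    obtain k where "k < n * (n - 1)" "r = row (design_mat_bar A) k"
      using r bar by (auto simp: rows_def)
    thus ?thesis using arg_cong[OF bar0, of "\<lambda>y. y $ k"] bar by simp
  qed
  have xi: "x $ i = A $$ (i, 0) * x $ 0" if "i < n" for i
  proof (cases "i = 0")
    case False
    thus ?thesis
      using equation_row_scalar_prod[OF A x that n False]
        row[OF equation_row_in_design_mat_bar_rows[OF A that n False]] by simp
  qed (simp add: A00)
  \<comment> \<open>The last row forces the entries of \<open>x\<close> to sum to zero. By
    \<open>xi\<close> this sum is the sum of column 0 of \<open>A\<close> times the entry of
    \<open>x\<close> at 0.\<close>
  have "0 = (ones_row n *\<^sub>v x) $ 0" using ones0 by simp
  also have "\<dots> = (\<Sum>i<n. x $ i)"
    using x by (auto simp: ones_row_def scalar_prod_def lessThan_atLeast0)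
  also have "\<dots> = (\<Sum>i<n. A $$ (i, 0)) * x $ 0"
    unfolding sum_distrib_right by (rule sum.cong[OF refl], rule xi) simp
  finally have "(\<Sum>i<n. A $$ (i, 0)) * x $ 0 = 0" by simp
  moreover have "0 < (\<Sum>i<n. A $$ (i, 0))"
    using n pos by (intro sum_pos) auto
  ultimately have "x $ 0 = 0" by simp
  hence "x $ i = 0" if "i < n" for i
    using xi[OF that] by simp
  thus ?thesis using x by auto
qed

section \<open>Symmetry, definiteness and invertibility of the Gram matrix\<close>

lemma gram_mat_carrier:
  assumes "A \<in> carrier_mat n n"
  shows "gram_mat A \<in> carrier_mat n n"
  using design_mat_carrier[OF assms] by (auto simp: gram_mat_def)

lemma gram_mat_symmetric:
  assumes "A \<in> carrier_mat n n"
  shows "transpose_mat (gram_mat A) = gram_mat A"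
  using design_mat_carrier[OF assms]
  by (simp add: gram_mat_def transpose_mult[of _ n "n * (n - 1) + 1" _ n])

lemma gram_mat_pos_def:
  assumes prm: "pairwise_reciprocal_mat n A" and x: "x \<in> carrier_vec n" "x \<noteq> 0\<^sub>v n"
  shows "0 < (gram_mat A *\<^sub>v x) \<bullet> x"
proof -
  have A: "A \<in> carrier_mat n n"
    using prm unfolding pairwise_reciprocal_mat_def by blast
  note D = design_mat_carrier[OF A]
  have "design_mat A *\<^sub>v x \<noteq> 0\<^sub>v (n * (n - 1) + 1)"
    using design_mat_kernel_trivial[OF prm] x by blast
  hence "0 < (design_mat A *\<^sub>v x) \<bullet> (design_mat A *\<^sub>v x)"
    using D scalar_prod_self_nonneg[of "design_mat A *\<^sub>v x"]
      scalar_prod_self_eq_0_iff[of "design_mat A *\<^sub>v x"] by (simp add: less_le)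
  thus ?thesis
    using transpose_mult_self_quadratic_form[OF D x(1)] by (simp add: gram_mat_def)
qed

lemma gram_mat_invertible:
  assumes prm: "pairwise_reciprocal_mat n A"
  shows "invertible_mat (gram_mat A)"
proof -
  have G: "gram_mat A \<in> carrier_mat n n"
    using prm unfolding pairwise_reciprocal_mat_def by (blast intro: gram_mat_carrier)
  \<comment> \<open>A nonzero kernel vector would make the quadratic form vanish, against
    \<open>gram_mat_pos_def\<close>.\<close>
  have "gram_mat A *\<^sub>v x \<noteq> 0\<^sub>v n" if "x \<in> carrier_vec n" "x \<noteq> 0\<^sub>v n" for x
    using gram_mat_pos_def[OF prm that] that by auto
  hence "det (gram_mat A) \<noteq> 0"
    using det_0_iff_vec_prod_zero[OF G] by blast
  thus ?thesis by (rule invertible_mat_if_det_nonzero[OF G])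
qed

text \<open>The double sum is the normalizing denominator of the weight vector, so its positivity
  makes the normalization legitimate.\<close>

lemma sum_entries_inverse_gram_mat_pos:
  assumes prm: "pairwise_reciprocal_mat n A"
  shows "0 < (\<Sum>i<n. \<Sum>j<n. mat_inv (gram_mat A) $$ (i, j))"
proof -
  have "A \<in> carrier_mat n n" and "2 \<le> n"
    using prm unfolding pairwise_reciprocal_mat_def by blast+
  hence G: "gram_mat A \<in> carrier_mat n n" and n: "0 < n"
    by (simp_all add: gram_mat_carrier)
  note inv = mat_inv[OF gram_mat_invertible[OF prm] G]
  define u :: "real vec" where "u = vec n (\<lambda>_. 1)"
  define z where "z = mat_inv (gram_mat A) *\<^sub>v u"
  have u: "u \<in> carrier_vec n" and z: "z \<in> carrier_vec n"
    using inv(1) by (auto simp: u_def z_def)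
  have Gz: "gram_mat A *\<^sub>v z = u"
    using assoc_mult_mat_vec[OF G inv(1) u] inv(2) u by (simp add: z_def)
  have "u \<noteq> 0\<^sub>v n"
    using n by (auto simp: u_def vec_eq_iff)
  \<comment> \<open>Otherwise \<open>u\<close>, the image of \<open>z\<close> under
    \<open>gram_mat A\<close>, would be zero, although it has an entry equal to 1.\<close>
  hence "z \<noteq> 0\<^sub>v n"
    using Gz G by auto
  hence "0 < u \<bullet> z"
    using gram_mat_pos_def[OF prm z] Gz by simp
  also have "u \<bullet> z = (\<Sum>i<n. z $ i)"
    using z by (auto simp: u_def scalar_prod_def lessThan_atLeast0)
  also have "\<dots> = (\<Sum>i<n. \<Sum>j<n. mat_inv (gram_mat A) $$ (i, j))"
    unfolding z_def u_def using mult_mat_vec_ones_index[OF inv(1)] by simp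
  finally show ?thesis .
qed

section \<open>The unnormalized solution as a vector of column sums\<close>

lemma rhs_row_mult_design_mat:
  assumes A: "A \<in> carrier_mat n n"
  shows "rhs_row n * design_mat A = ones_row n"
proof (rule eq_matI)
  let ?m = "n * (n - 1)"
  fix i j assume "i < dim_row (ones_row n)" "j < dim_col (ones_row n)"
  hence i: "i = 0" and j: "j < n" by (auto simp: ones_row_def)
  note D = design_mat_carrier[OF A]
  have "(rhs_row n * design_mat A) $$ (0, j)
      = (\<Sum>k<?m + 1. if k = ?m then design_mat A $$ (k, j) else 0)"
    using D j by (auto simp: rhs_row_def scalar_prod_def lessThan_atLeast0 intro!: sum.cong)
  \<comment> \<open>Counting from 0, row \<open>?m\<close> is the first one after the
    \<open>?m\<close> rows of \<open>design_mat_bar A\<close>, that is, the appended row of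
    ones.\<close>
  also have "\<dots> = design_mat A $$ (?m, j)" by simp
  also have "\<dots> = 1"
    using design_mat_bar_carrier[OF A] A j
    by (simp add: design_mat_def append_rows_def ones_row_def)
  finally show "(rhs_row n * design_mat A) $$ (i, j) = ones_row n $$ (i, j)"
    using i j by (simp add: ones_row_def)
qed (use design_mat_carrier[OF A] in \<open>auto simp: rhs_row_def ones_row_def\<close>)

lemma pseudo_igm_unnormalized_eq:
  assumes prm: "pairwise_reciprocal_mat n A"
  shows "pseudo_igm_unnormalized A = ones_row n * mat_inv (gram_mat A)"
proof -
  have A: "A \<in> carrier_mat n n"
    using prm unfolding pairwise_reciprocal_mat_def by blast
  let ?m = "n * (n - 1) + 1" and ?H = "mat_inv (gram_mat A)" and ?D = "design_mat A"
  note G = gram_mat_carrier[OF A] and D = design_mat_carrier[OF A]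
  note Ginv = gram_mat_invertible[OF prm]
  have H: "?H \<in> carrier_mat n n" by (rule mat_inv(1)[OF Ginv G])
  have q: "rhs_row n \<in> carrier_mat 1 ?m" by (simp add: rhs_row_def)
  \<comment> \<open>Reassociation isolates the transpose of \<open>rhs_row n * design_mat A\<close>,
    which is the column of ones.\<close>
  have "?H * transpose_mat ?D * transpose_mat (rhs_row n)
      = ?H * (transpose_mat ?D * transpose_mat (rhs_row n))"
    using H D q by (intro assoc_mult_mat) auto
  also have "transpose_mat ?D * transpose_mat (rhs_row n) = transpose_mat (ones_row n)"
    using transpose_mult[OF q D] rhs_row_mult_design_mat[OF A] by simp
  finally have "pseudo_igm_unnormalized A = transpose_mat (?H * transpose_mat (ones_row n))"
    using A by (simp add: pseudo_igm_unnormalized_def gram_mat_def)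
  also have "\<dots> = ones_row n * transpose_mat ?H"
    using transpose_mult[OF H, of "transpose_mat (ones_row n)" 1] ones_row_carrier by simp
  finally show ?thesis
    using transpose_mat_inv_symmetric[OF Ginv G gram_mat_symmetric[OF A]] by simp
qed

theorem theorem1:
  fixes n :: nat and A D G e v w :: "real mat"
  assumes "pairwise_reciprocal_mat n A"
    and "D = design_mat A"
    and "G = gram_mat A"
    and "e = ones_row n"
    and "v = pseudo_igm_unnormalized A"
    and "w = pseudo_igm A"
  shows "invertible_mat G \<and>
    scalar_of_mat (v * transpose_mat e) \<noteq> 0 \<and>
    scalar_of_mat (e * mat_inv G * transpose_mat e) \<noteq> 0 \<and>
    w = (1 / scalar_of_mat (e * mat_inv G * transpose_mat e)) \<cdot>\<^sub>m (e * mat_inv G) \<and>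
    w = (1 / scalar_of_mat (e * mat_inv (transpose_mat D * D) * transpose_mat e)) \<cdot>\<^sub>m (e * mat_inv (transpose_mat D * D)) \<and>
    transpose_mat G = G \<and>
    transpose_mat (mat_inv G) = mat_inv G \<and>
    (\<forall>i<n. (e * mat_inv G) $$ (0, i) = (\<Sum>k<n. mat_inv G $$ (k, i))) \<and>
    (\<forall>i<n. (mat_inv G * transpose_mat e) $$ (i, 0) = (\<Sum>k<n. mat_inv G $$ (i, k))) \<and>
    (\<forall>i<n. (e * mat_inv G) $$ (0, i) = (mat_inv G * transpose_mat e) $$ (i, 0)) \<and>
    scalar_of_mat (e * mat_inv G * transpose_mat e) = (\<Sum>i<n. (e * mat_inv G) $$ (0, i)) \<and>
    (\<Sum>i<n. w $$ (0, i)) = 1"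
proof -
  have A: "A \<in> carrier_mat n n"
    using assms(1) unfolding pairwise_reciprocal_mat_def by blast
  have G: "G \<in> carrier_mat n n" and Ginv: "invertible_mat G" and Gsym: "transpose_mat G = G"
    using gram_mat_carrier[OF A] gram_mat_invertible[OF assms(1)] gram_mat_symmetric[OF A]
    by (simp_all add: assms(3))
  have DG: "transpose_mat D * D = G"
    by (simp add: assms(2,3) gram_mat_def)
  have H: "mat_inv G \<in> carrier_mat n n" by (rule mat_inv(1)[OF Ginv G])
  have Hsym: "transpose_mat (mat_inv G) = mat_inv G"
    by (rule transpose_mat_inv_symmetric[OF Ginv G Gsym])
  have eH: "e * mat_inv G \<in> carrier_mat 1 n"
    unfolding assms(4) by (rule mult_carrier_mat[OF ones_row_carrier H])
  have cols: "(e * mat_inv G) $$ (0, i) = (\<Sum>k<n. mat_inv G $$ (k, i))" if "i < n" for i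
    using ones_row_mult_index[OF H that] by (simp add: assms(4))
  have rows: "(mat_inv G * transpose_mat e) $$ (i, 0) = (\<Sum>k<n. mat_inv G $$ (i, k))"
    if "i < n" for i
    using mult_ones_col_index[OF H that] by (simp add: assms(4))
  \<comment> \<open>Symmetry of the inverse, read entry by entry, is what identifies its column sums
    with its row sums.\<close>
  have sym: "mat_inv G $$ (k, i) = mat_inv G $$ (i, k)" if "i < n" "k < n" for i k
    using arg_cong[OF Hsym, of "\<lambda>M. M $$ (i, k)"] that H by simp
  have cols_rows: "(e * mat_inv G) $$ (0, i) = (mat_inv G * transpose_mat e) $$ (i, 0)"
    if "i < n" for i
    using sym that by (simp add: cols rows)
  have total: "scalar_of_mat (e * mat_inv G * transpose_mat e) = (\<Sum>i<n. (e * mat_inv G) $$ (0, i))"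
    using mult_ones_col_index[OF eH, of 0] by (simp add: assms(4) scalar_of_mat_def)
  \<comment> \<open>Passing to row sums gives the double sum the index order of
    \<open>sum_entries_inverse_gram_mat_pos\<close>.\<close>
  have "(\<Sum>i<n. (e * mat_inv G) $$ (0, i)) = (\<Sum>i<n. \<Sum>k<n. mat_inv G $$ (i, k))"
    by (simp add: cols_rows rows)
  hence nonzero: "scalar_of_mat (e * mat_inv G * transpose_mat e) \<noteq> 0"
    using sum_entries_inverse_gram_mat_pos[OF assms(1)] total by (simp add: assms(3))
  have v: "v = e * mat_inv G"
    using pseudo_igm_unnormalized_eq[OF assms(1)] by (simp add: assms(3,4,5))
  have w: "w = (1 / scalar_of_mat (e * mat_inv G * transpose_mat e)) \<cdot>\<^sub>m (e * mat_inv G)"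
    using v A by (simp add: assms(4,5,6) pseudo_igm_def)
  have "(\<Sum>i<n. w $$ (0, i))
      = (\<Sum>i<n. 1 / scalar_of_mat (e * mat_inv G * transpose_mat e) * (e * mat_inv G) $$ (0, i))"
    unfolding w using carrier_matD[OF eH] by (intro sum.cong refl index_smult_mat(1)) auto
  \<comment> \<open>Here the total cancels against itself. Division by zero yields 0 in HOL, so with
    a vanishing total the weights would sum to 0; \<open>nonzero\<close> excludes this.\<close>
  also have "\<dots> = 1"
    using nonzero by (simp add: sum_divide_distrib[symmetric] total[symmetric])
  finally have "(\<Sum>i<n. w $$ (0, i)) = 1" .
  \<comment> \<open>Unfolding \<open>DG\<close> makes the two formulas for \<open>w\<close>
    coincide, and \<open>v\<close> carries \<open>nonzero\<close> over to the denominator in the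
    definition of \<open>w\<close>.\<close>
  with Ginv Gsym Hsym cols rows cols_rows total nonzero v w show ?thesis
    unfolding DG by blast
qed

end
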